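(* Let $C$ be a $(K,F,r)$-computing matrix with a non-overlapping identity submatrix cover $\mathfrak{C}=\{C_1,\dots,C_S\}$ such that each identity submatrix $C_i$ has size $g\geq 2$, representing a computing system to reduce $Q$ functions, and let $\beta=Q/K$. Suppose that (a) $\gamma=\frac{S}{K}$ is an integer, and (b) each server $k$ appears in the row indices of the same number of identity submatrices in $\mathfrak{C}$. Then the two-transmissions-per-identity-submatrix coded data shuffling scheme (described in the context) is achievable with the property of load balancing, i.e., the transmitting servers can be chosen so that the total number of bits transmitted by each node is exactly $\frac{2S\beta T}{K}$, out of which $\frac{S\beta T}{K}$ bits correspond to coded bits and the other $\frac{S\beta T}{K}$ bits correspond to uncoded bits.
   Context: Identity submatrices: an $l\times l$ submatrix $B$ of a binary ($0/1$) matrix $A$ is an identity submatrix of size $l$ if its columns are those of the $l\times l$ identity matrix in some order, i.e. $B$ is a permutation matrix. An entry $A(i,j)=1$ is covered by $B$ if $i$ is a row index and $j$ a column index of $B$. A set $\{C_1,\dots,C_S\}$ of identity submatrices of $A$ is an identity submatrix cover of $A$ if each non-zero entry of $A$ is covered by at least one $C_i$; it is non-overlapping if no non-zero entry is covered by two distinct members. Coded MapReduce model: there are $K$ servers (nodes) indexed by $\mathcal{K}$, and an input file divided into $F$ subfiles indexed by $\mathcal{F}$, $|\mathcal{F}|=F\geq K$. There are $Q$ output functions, with $\beta=Q/K$ an integer. For $q\in[Q]$, $f\in\mathcal{F}$ there is an intermediate value (IVA) $v_{q,f}$, an arbitrary string of $T$ bits, computable from subfile $f$; the $q$-th output function is computed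 (reduced) from $\{v_{q,f}:f\in\mathcal{F}\}$. Server $k$ has to reduce the $\beta$ functions $\mathcal{W}_k=\{q_{(k,b)}:b\in[\beta]\}$, these sets being disjoint with union $[Q]$. Computing matrix: a binary matrix $C$ with rows indexed by the $K$-set $\mathcal{K}$ and columns by the $F$-set $\mathcal{F}$ such that each column has the same number $r$ of $0$'s is a $(K,F,r)$-computing matrix; server $k$ maps subfile $f$ (computes $v_{q,f}$ for all $q\in[Q]$) if and only if $C(k,f)=0$. In the shuffle phase servers broadcast messages so that each server $k$ obtains all $v_{q,f}$ with $q\in\mathcal{W}_k$ and $C(k,f)=1$. Shuffling scheme: for each $C_s\in\mathfrak{C}$, with rows $k_1,\dots,k_g$ and columns $f_1,\dots,f_g$ labelled so that $C(k_i,f_j)=1$ iff $i=j$, two different servers $k_p,k_m$ among $k_1,\dots,k_g$ are chosen; $k_p$ makes the coded transmission of $\beta T$ bits $\left\{\sum_{i\neq p}v_{q_{(k_i,b)},f_i}:b\in[\beta]\right\}$ (sums are bitwise XOR), and $k_m$ makes the uncoded transmission of $\beta T$ bits $\{v_{q_{(k_p,b)},f_p}:b\in[\beta]\}$. (This scheme delivers all required IVAs with communication load, i.e. total transmitted bits divided by $QFT$, equal to $\frac{2}{g}(1-\frac{r}{K})$.) *)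

theory Defs
  imports Complex_Main "HOL-Library.FuncSet" "HOL-Library.Z2"
begin

text \<open>
  Binary matrices are functions into \<^typ>\<open>bit\<close> (the field with two elements), with explicit
  finite row set \<open>KK\<close> (servers) and column set \<open>FF\<close> (subfiles); values elsewhere are irrelevant.
  A submatrix is represented by its row index set and its column index set.
\<close>

type_synonym ('k, 'f) submatrix = "'k set \<times> 'f set"

definition computing_matrix ::
  "'k set \<Rightarrow> 'f set \<Rightarrow> nat \<Rightarrow> nat \<Rightarrow> nat \<Rightarrow> ('k \<Rightarrow> 'f \<Rightarrow> bit) \<Rightarrow> bool" where
  "computing_matrix KK FF K F r C \<longleftrightarrow>
     finite KK \<and> card KK = K \<and> finite FF \<and> card FF = F \<and>
     (\<forall>f\<in>FF. card {k \<in> KK. C k f = 0} = r)"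

definition identity_submatrix ::
  "'k set \<Rightarrow> 'f set \<Rightarrow> ('k \<Rightarrow> 'f \<Rightarrow> bit) \<Rightarrow> nat \<Rightarrow> ('k, 'f) submatrix \<Rightarrow> bool" where
  "identity_submatrix KK FF C l B \<longleftrightarrow>
     fst B \<subseteq> KK \<and> snd B \<subseteq> FF \<and> card (fst B) = l \<and> card (snd B) = l \<and>
     (\<exists>\<sigma>. bij_betw \<sigma> (fst B) (snd B) \<and>
          (\<forall>k\<in>fst B. \<forall>f\<in>snd B. C k f = (if f = \<sigma> k then 1 else 0)))"

text \<open>Only used for pairs \<open>(k, f)\<close> at which the matrix has entry \<open>1\<close>.\<close>

definition covers :: "('k, 'f) submatrix \<Rightarrow> 'k \<Rightarrow> 'f \<Rightarrow> bool" where
  "covers B k f \<longleftrightarrow> k \<in> fst B \<and> f \<in> snd B"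

definition identity_cover ::
  "'k set \<Rightarrow> 'f set \<Rightarrow> ('k \<Rightarrow> 'f \<Rightarrow> bit) \<Rightarrow> ('k, 'f) submatrix set \<Rightarrow> bool" where
  "identity_cover KK FF C \<CC> \<longleftrightarrow>
     (\<forall>B\<in>\<CC>. \<exists>l. identity_submatrix KK FF C l B) \<and>
     (\<forall>k\<in>KK. \<forall>f\<in>FF. C k f = 1 \<longrightarrow> (\<exists>B\<in>\<CC>. covers B k f))"

definition non_overlapping ::
  "'k set \<Rightarrow> 'f set \<Rightarrow> ('k \<Rightarrow> 'f \<Rightarrow> bit) \<Rightarrow> ('k, 'f) submatrix set \<Rightarrow> bool" where
  "non_overlapping KK FF C \<CC> \<longleftrightarrow>
     (\<forall>k\<in>KK. \<forall>f\<in>FF. C k f = 1 \<longrightarrow>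
        \<not> (\<exists>B\<in>\<CC>. \<exists>B'\<in>\<CC>. B \<noteq> B' \<and> covers B k f \<and> covers B' k f))"

text \<open>
  Functions to be reduced are numbered \<open>1, \<dots>, Q\<close>; \<open>q k b\<close> is the \<open>b\<close>-th function reduced by
  server \<open>k\<close>.
\<close>

definition reduce_set :: "('k \<Rightarrow> nat \<Rightarrow> nat) \<Rightarrow> nat \<Rightarrow> 'k \<Rightarrow> nat set" where
  "reduce_set q \<beta> k = {q k b | b. b \<in> {1..\<beta>}}"

definition reduce_assignment :: "'k set \<Rightarrow> nat \<Rightarrow> nat \<Rightarrow> ('k \<Rightarrow> nat \<Rightarrow> nat) \<Rightarrow> bool" where
  "reduce_assignment KK Q \<beta> q \<longleftrightarrow>
     (\<forall>k\<in>KK. \<forall>k'\<in>KK. k \<noteq> k' \<longrightarrow> reduce_set q \<beta> k \<inter> reduce_set q \<beta> k' = {}) \<and>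
     (\<Union>k\<in>KK. reduce_set q \<beta> k) = {1..Q}"

type_synonym 'f iva = "nat \<Rightarrow> 'f \<Rightarrow> bit list"

definition ivas :: "nat \<Rightarrow> 'f set \<Rightarrow> nat \<Rightarrow> 'f iva set" where
  "ivas Q FF T = {v. \<forall>j\<in>{1..Q}. \<forall>f\<in>FF. length (v j f) = T}"

definition mapped_ivas ::
  "nat \<Rightarrow> 'f set \<Rightarrow> ('k \<Rightarrow> 'f \<Rightarrow> bit) \<Rightarrow> 'f iva \<Rightarrow> 'k \<Rightarrow> nat \<times> 'f \<Rightarrow> bit list" where
  "mapped_ivas Q FF C v k = (\<lambda>(j, f)\<in>{1..Q} \<times> {f \<in> FF. C k f = 0}. v j f)"

text \<open>
  A shuffle phase is given by a set \<open>X\<close> of broadcasts, where broadcast \<open>x\<close> is sent by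
  server \<open>snd_by x\<close> and has content \<open>msg v x\<close> when the intermediate values are \<open>v\<close>. It must be
  possible for the sender to compute the message from the values it has mapped, and for every
  server to recover the values it lacks from those it has mapped and all the broadcasts.
  The encoders and decoders must not depend on \<open>v\<close>.
\<close>

definition transmittable ::
  "'k set \<Rightarrow> 'f set \<Rightarrow> ('k \<Rightarrow> 'f \<Rightarrow> bit) \<Rightarrow> nat \<Rightarrow> nat \<Rightarrow>
   'x set \<Rightarrow> ('x \<Rightarrow> 'k) \<Rightarrow> ('f iva \<Rightarrow> 'x \<Rightarrow> bit list) \<Rightarrow> bool" where
  "transmittable KK FF C Q T X snd_by msg \<longleftrightarrow>
     (\<forall>x\<in>X. snd_by x \<in> KK \<and>
        (\<exists>enc. \<forall>v\<in>ivas Q FF T. msg v x = enc (mapped_ivas Q FF C v (snd_by x))))"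

definition delivers ::
  "'k set \<Rightarrow> 'f set \<Rightarrow> ('k \<Rightarrow> 'f \<Rightarrow> bit) \<Rightarrow> nat \<Rightarrow> nat \<Rightarrow> nat \<Rightarrow> ('k \<Rightarrow> nat \<Rightarrow> nat) \<Rightarrow>
   'x set \<Rightarrow> ('f iva \<Rightarrow> 'x \<Rightarrow> bit list) \<Rightarrow> bool" where
  "delivers KK FF C Q T \<beta> q X msg \<longleftrightarrow>
     (\<forall>k\<in>KK. \<forall>j\<in>reduce_set q \<beta> k. \<forall>f\<in>FF. C k f = 1 \<longrightarrow>
        (\<exists>dec. \<forall>v\<in>ivas Q FF T.
           v j f = dec (mapped_ivas Q FF C v k) (restrict (msg v) X)))"

definition bits_sent ::
  "'x set \<Rightarrow> ('x \<Rightarrow> 'k) \<Rightarrow> ('f iva \<Rightarrow> 'x \<Rightarrow> bit list) \<Rightarrow> 'f iva \<Rightarrow> 'k \<Rightarrow> nat" where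
  "bits_sent X snd_by msg v k = (\<Sum>x\<in>{x \<in> X. snd_by x = k}. length (msg v x))"

text \<open>
  Bitwise XOR of strings of length \<open>T\<close>: addition in \<^typ>\<open>bit\<close> is exclusive or.
\<close>

definition xor_sum :: "nat \<Rightarrow> 'i set \<Rightarrow> ('i \<Rightarrow> bit list) \<Rightarrow> bit list" where
  "xor_sum T I w = map (\<lambda>t. \<Sum>i\<in>I. w i ! t) [0..<T]"

text \<open>
  The column labelled like row \<open>k\<close> of the identity submatrix \<open>B\<close>, i.e. \<open>f\<^sub>i\<close> for \<open>k = k\<^sub>i\<close>.
\<close>

definition col_of :: "('k \<Rightarrow> 'f \<Rightarrow> bit) \<Rightarrow> ('k, 'f) submatrix \<Rightarrow> 'k \<Rightarrow> 'f" where
  "col_of C B k = (THE f. f \<in> snd B \<and> C k f = 1)"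

text \<open>
  The broadcasts of the scheme: for every submatrix \<open>B\<close> of the cover and every \<open>b\<close>, a coded one
  sent by the server \<open>p B\<close> and an uncoded one sent by the server \<open>m B\<close>.
\<close>

datatype ('k, 'f) broadcast =
  Coded "('k, 'f) submatrix" nat | Uncoded "('k, 'f) submatrix" nat

definition coded_broadcasts :: "('k, 'f) submatrix set \<Rightarrow> nat \<Rightarrow> ('k, 'f) broadcast set" where
  "coded_broadcasts \<CC> \<beta> = {Coded B b | B b. B \<in> \<CC> \<and> b \<in> {1..\<beta>}}"

definition uncoded_broadcasts :: "('k, 'f) submatrix set \<Rightarrow> nat \<Rightarrow> ('k, 'f) broadcast set" where
  "uncoded_broadcasts \<CC> \<beta> = {Uncoded B b | B b. B \<in> \<CC> \<and> b \<in> {1..\<beta>}}"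

definition all_broadcasts :: "('k, 'f) submatrix set \<Rightarrow> nat \<Rightarrow> ('k, 'f) broadcast set" where
  "all_broadcasts \<CC> \<beta> = coded_broadcasts \<CC> \<beta> \<union> uncoded_broadcasts \<CC> \<beta>"

fun sender ::
  "(('k, 'f) submatrix \<Rightarrow> 'k) \<Rightarrow> (('k, 'f) submatrix \<Rightarrow> 'k) \<Rightarrow> ('k, 'f) broadcast \<Rightarrow> 'k" where
  "sender p m (Coded B b) = p B"
| "sender p m (Uncoded B b) = m B"

fun message ::
  "('k \<Rightarrow> 'f \<Rightarrow> bit) \<Rightarrow> nat \<Rightarrow> ('k \<Rightarrow> nat \<Rightarrow> nat) \<Rightarrow> (('k, 'f) submatrix \<Rightarrow> 'k) \<Rightarrow>
   'f iva \<Rightarrow> ('k, 'f) broadcast \<Rightarrow> bit list" where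
  "message C T q p v (Coded B b) =
     xor_sum T (fst B - {p B}) (\<lambda>k. v (q k b) (col_of C B k))"
| "message C T q p v (Uncoded B b) = v (q (p B) b) (col_of C B (p B))"

definition transmitter_choice ::
  "('k, 'f) submatrix set \<Rightarrow> (('k, 'f) submatrix \<Rightarrow> 'k) \<Rightarrow> (('k, 'f) submatrix \<Rightarrow> 'k) \<Rightarrow> bool"
  where
  "transmitter_choice \<CC> p m \<longleftrightarrow> (\<forall>B\<in>\<CC>. p B \<in> fst B \<and> m B \<in> fst B \<and> p B \<noteq> m B)"

end

theory Submission
  imports Defs
begin

text \<open>
  Double counting gives that every server lies in exactly \<open>\<gamma> g\<close> submatrices of the cover, where
  \<open>\<gamma> = S / K\<close>. So the graph joining each submatrix to \<open>\<gamma>\<close> copies of each of its rows is a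
  \<open>\<gamma> g\<close>-regular bipartite graph; a perfect matching, given by Hall's theorem, selects the coded
  transmitters \<open>p\<close>, each server being used \<open>\<gamma>\<close> times. Deleting the row \<open>p B\<close> from every \<open>B\<close>
  leaves sets of size \<open>g - 1 > 0\<close> such that every server lies in \<open>\<gamma> (g - 1)\<close> of them, so the same
  argument selects the uncoded transmitters.
\<close>

section \<open>Balanced systems of representatives\<close>

text \<open>Induction on \<open>A\<close> in the style of Halmos and Vaughan. If some nonempty
  proper subset \<open>J\<close> is tight, meaning that it has exactly \<open>card J\<close>
  neighbours, it is matched inside its own neighbourhood and the rest of \<open>A\<close> outside
  it. Otherwise every nonempty proper subset has a spare neighbour, so one element may take any of
  its neighbours.\<close>

lemma hall:
  fixes N :: "'a \<Rightarrow> 'b set"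
  assumes "finite A" "\<And>a. a \<in> A \<Longrightarrow> finite (N a)"
    and "\<And>J. J \<subseteq> A \<Longrightarrow> card J \<le> card (\<Union>(N ` J))"
  shows "\<exists>f. inj_on f A \<and> (\<forall>a\<in>A. f a \<in> N a)"
  using assms
proof (induction A arbitrary: N rule: finite_psubset_induct)
  case (psubset A)
  show ?case
  proof (cases "\<exists>J. J \<subset> A \<and> J \<noteq> {} \<and> card J = card (\<Union>(N ` J))")
    case True
    then obtain J where J: "J \<subset> A" "J \<noteq> {}" "card J = card (\<Union>(N ` J))" by blast
    define U where "U = \<Union>(N ` J)"
    have "\<exists>f. inj_on f J \<and> (\<forall>a\<in>J. f a \<in> N a)"
      by (rule psubset.IH) (use J psubset.prems in auto)
    then obtain f where f: "inj_on f J" "\<forall>a\<in>J. f a \<in> N a" by blast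
    have "\<exists>h. inj_on h (A - J) \<and> (\<forall>a\<in>A - J. h a \<in> N a - U)"
    proof (rule psubset.IH)
      fix L assume L: "L \<subseteq> A - J"
      \<comment> \<open>Hall's condition for \<open>J \<union> L\<close>, minus the tight equality
        for \<open>J\<close>, is Hall's condition for \<open>L\<close> once \<open>U\<close> is
        deleted.\<close>
      have "card J + card L = card (J \<union> L)"
        using L J psubset.hyps by (subst card_Un_disjoint) (auto intro: finite_subset)
      also have "\<dots> \<le> card (\<Union>(N ` (J \<union> L)))"
        using L J by (intro psubset.prems(2)) auto
      also have "\<Union>(N ` (J \<union> L)) = U \<union> (\<Union>a\<in>L. N a - U)"
        by (auto simp: U_def)
      also have "card \<dots> \<le> card U + card (\<Union>a\<in>L. N a - U)"
        by (rule card_Un_le)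
      finally show "card L \<le> card (\<Union>a\<in>L. N a - U)"
        using J(3) by (simp add: U_def)
    qed (use J psubset.prems in auto)
    then obtain h where h: "inj_on h (A - J)" "\<forall>a\<in>A - J. h a \<in> N a - U" by blast
    have "f a \<noteq> h b" if "a \<in> J" "b \<in> A - J" for a b
      using that f(2) h(2) unfolding U_def by fastforce
    then have "inj_on (\<lambda>a. if a \<in> J then f a else h a) A"
      using f(1) h(1) unfolding inj_on_def by (metis DiffI)
    moreover have "\<forall>a\<in>A. (if a \<in> J then f a else h a) \<in> N a"
      using f(2) h(2) by auto
    ultimately show ?thesis by blast
  next
    case False
    then have strict: "card L < card (\<Union>(N ` L))" if "L \<subset> A" "L \<noteq> {}" for L
      using that psubset.prems(2)[of L] by (metis le_neq_implies_less psubset_imp_subset)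
    show ?thesis
    proof (cases "A = {}")
      case True
      then show ?thesis by auto
    next
      case False
      then obtain a where a: "a \<in> A" by blast
      have "N a \<noteq> {}"
        using psubset.prems(2)[of "{a}"] a by auto
      then obtain y where y: "y \<in> N a" by blast
      have "\<exists>h. inj_on h (A - {a}) \<and> (\<forall>x\<in>A - {a}. h x \<in> N x - {y})"
      proof (rule psubset.IH)
        fix L assume L: "L \<subseteq> A - {a}"
        show "card L \<le> card (\<Union>x\<in>L. N x - {y})"
        proof (cases "L = {}")
          case False
          \<comment> \<open>The spare neighbour pays for the loss of \<open>y\<close>.\<close>
          have "card L < card (\<Union>(N ` L))"
            using strict[of L] L a False by blast
          moreover have "(\<Union>x\<in>L. N x - {y}) = \<Union>(N ` L) - {y}" by blast
          ultimately show ?thesis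
            by (auto simp: card_Diff_singleton_if)
        qed simp
      qed (use a psubset.prems in auto)
      then obtain h where h: "inj_on h (A - {a})" "\<forall>x\<in>A - {a}. h x \<in> N x - {y}" by blast
      have "inj_on (h(a := y)) A"
        using h unfolding inj_on_def by auto
      moreover have "\<forall>x\<in>A. (h(a := y)) x \<in> N x"
        using h(2) y by auto
      ultimately show ?thesis by blast
    qed
  qed
qed

text \<open>Both sides count the pairs \<open>(a, x)\<close> with \<open>x \<in> R a\<close>, sorted
  by \<open>a\<close> and by \<open>x\<close> respectively.\<close>

lemma sum_card_incidence:
  assumes "finite A" "finite X" "\<And>a. a \<in> A \<Longrightarrow> R a \<subseteq> X"
  shows "(\<Sum>a\<in>A. card (R a)) = (\<Sum>x\<in>X. card {a \<in> A. x \<in> R a})"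
proof -
  have "(\<Sum>a\<in>A. card (R a)) = (\<Sum>a\<in>A. card {x \<in> X. x \<in> R a})"
    using assms(3) by (intro sum.cong refl arg_cong[where f = card]) auto
  also have "\<dots> = (\<Sum>x\<in>X. card {a \<in> A. x \<in> R a})"
    using sum.swap_restrict[OF assms(1,2), of "\<lambda>_ _. 1::nat" "\<lambda>a x. x \<in> R a"] by simp
  finally show ?thesis .
qed

text \<open>Splitting each \<open>x\<close> into \<open>c\<close> copies \<open>(x, i)\<close> turns
  the quota into injectivity, so Hall's theorem applies. Counting incidences also gives
  \<open>card A = c * card X\<close>; the injection is therefore onto, and every \<open>x\<close> is
  used exactly \<open>c\<close> times, not merely at most \<open>c\<close> times.\<close>

lemma balanced_representatives:
  assumes "finite A" "finite X" "h > 0"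
    and sub: "\<And>a. a \<in> A \<Longrightarrow> R a \<subseteq> X"
    and size: "\<And>a. a \<in> A \<Longrightarrow> card (R a) = h"
    and deg: "\<And>x. x \<in> X \<Longrightarrow> card {a \<in> A. x \<in> R a} = c * h"
  shows "\<exists>f. (\<forall>a\<in>A. f a \<in> R a) \<and> (\<forall>x\<in>X. card {a \<in> A. f a = x} = c)"
proof -
  have finR: "finite (R a)" if "a \<in> A" for a
    using sub[OF that] assms(2) finite_subset by blast
  have "\<exists>f. inj_on f A \<and> (\<forall>a\<in>A. f a \<in> R a \<times> {..<c})"
  proof (rule hall)
    fix J assume J: "J \<subseteq> A"
    define U where "U = \<Union>(R ` J)"
    have U: "U \<subseteq> X" using J sub unfolding U_def by blast
    have finU: "finite U" using U assms(2) by (rule finite_subset)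
    have finJ: "finite J" using J assms(1) finite_subset by blast
    have "card J * h = (\<Sum>a\<in>J. card (R a))"
      using J size by (simp add: subset_iff)
    also have "\<dots> = (\<Sum>x\<in>U. card {a \<in> J. x \<in> R a})"
      using finJ finU by (intro sum_card_incidence) (auto simp: U_def)
    \<comment> \<open>Regularity enters here: the \<open>card J * h\<close> incidences of
      \<open>J\<close> all end in \<open>U\<close>, where each point has only \<open>c * h\<close>
      of them. Cancelling \<open>h > 0\<close> leaves Hall's condition.\<close>
    also have "\<dots> \<le> (\<Sum>x\<in>U. card {a \<in> A. x \<in> R a})"
      using J assms(1) by (intro sum_mono card_mono) auto
    also have "\<dots> = card U * c * h"
      using U deg by (simp add: subset_iff)
    finally have "card J \<le> card U * c"
      using assms(3) by simp
    also have "\<dots> = card (U \<times> {..<c})" by (simp add: card_cartesian_product)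
    also have "U \<times> {..<c} = (\<Union>a\<in>J. R a \<times> {..<c})" by (auto simp: U_def)
    finally show "card J \<le> card (\<Union>a\<in>J. R a \<times> {..<c})" .
  qed (use assms finR in auto)
  then obtain f where f: "inj_on f A" "\<forall>a\<in>A. f a \<in> R a \<times> {..<c}" by blast
  have "card A * h = (\<Sum>x\<in>X. card {a \<in> A. x \<in> R a})"
    using sum_card_incidence[OF assms(1,2) sub] size by simp
  then have "card A = card (X \<times> {..<c})"
    using deg assms(3) by (simp add: card_cartesian_product)
  moreover have "f ` A \<subseteq> X \<times> {..<c}"
    using f(2) sub by fastforce
  ultimately have onto: "f ` A = X \<times> {..<c}"
    using f(1) assms(2) by (intro card_subset_eq) (auto simp: card_image)
  have "card {a \<in> A. fst (f a) = x} = c" if "x \<in> X" for x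
  proof -
    have "f ` {a \<in> A. fst (f a) = x} = {y \<in> f ` A. fst y = x}" by blast
    also have "\<dots> = {x} \<times> {..<c}" using that unfolding onto by auto
    finally have "card (f ` {a \<in> A. fst (f a) = x}) = c" by simp
    then show ?thesis
      using f(1) by (subst (asm) card_image) (auto intro: inj_on_subset)
  qed
  moreover have "\<forall>a\<in>A. fst (f a) \<in> R a" using f(2) by auto
  ultimately show ?thesis by (intro exI[of _ "\<lambda>a. fst (f a)"]) blast
qed

lemma two_balanced_representatives:
  assumes "finite A" "finite X" "g \<ge> 2"
    and sub: "\<And>a. a \<in> A \<Longrightarrow> R a \<subseteq> X"
    and size: "\<And>a. a \<in> A \<Longrightarrow> card (R a) = g"
    and deg: "\<And>x. x \<in> X \<Longrightarrow> card {a \<in> A. x \<in> R a} = c * g"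
  shows "\<exists>p m. (\<forall>a\<in>A. p a \<in> R a \<and> m a \<in> R a \<and> p a \<noteq> m a) \<and>
    (\<forall>x\<in>X. card {a \<in> A. p a = x} = c \<and> card {a \<in> A. m a = x} = c)"
proof -
  have "\<exists>p. (\<forall>a\<in>A. p a \<in> R a) \<and> (\<forall>x\<in>X. card {a \<in> A. p a = x} = c)"
    by (rule balanced_representatives[where h = g]) (use assms in auto)
  then obtain p where p: "\<forall>a\<in>A. p a \<in> R a" "\<forall>x\<in>X. card {a \<in> A. p a = x} = c"
    by blast
  have "\<exists>m. (\<forall>a\<in>A. m a \<in> R a - {p a}) \<and> (\<forall>x\<in>X. card {a \<in> A. m a = x} = c)"
  proof (rule balanced_representatives[where h = "g - 1"])
    fix x assume x: "x \<in> X"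
    \<comment> \<open>Since \<open>p\<close> is balanced, each \<open>x\<close> loses exactly
      \<open>c\<close> incidences, so the reduced sets are again regular with the same quota
      \<open>c\<close>.\<close>
    have "{a \<in> A. x \<in> R a - {p a}} = {a \<in> A. x \<in> R a} - {a \<in> A. p a = x}" by auto
    moreover have "{a \<in> A. p a = x} \<subseteq> {a \<in> A. x \<in> R a}" using p(1) by auto
    ultimately have "card {a \<in> A. x \<in> R a - {p a}} = c * g - c"
      using assms(1) deg[OF x] p(2) x by (simp add: card_Diff_subset)
    then show "card {a \<in> A. x \<in> R a - {p a}} = c * (g - 1)"
      by (simp add: diff_mult_distrib2)
  next
    fix a assume "a \<in> A"
    then show "card (R a - {p a}) = g - 1"
      using p(1) size by simp
  next
    fix a assume "a \<in> A"
    then show "R a - {p a} \<subseteq> X" using sub by blast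
  qed (use assms in auto)
  then obtain m where "\<forall>a\<in>A. m a \<in> R a - {p a}" "\<forall>x\<in>X. card {a \<in> A. m a = x} = c"
    by blast
  with p show ?thesis by (intro exI[of _ p] exI[of _ m]) auto
qed

section \<open>The shuffling scheme\<close>

text \<open>A row of a permutation matrix has a single 1, so the description in
  \<open>col_of\<close> denotes \<open>\<sigma> k\<close>. Injectivity of \<open>\<sigma>\<close>
  puts a 0 in that column at every other row, which is what lets the other servers of
  \<open>B\<close> know the value that \<open>k\<close> lacks.\<close>

lemma identity_submatrix_col_of:
  assumes "identity_submatrix KK FF C l B" "k \<in> fst B"
  shows "col_of C B k \<in> snd B"
    and "f \<in> snd B \<Longrightarrow> C k f = 1 \<longleftrightarrow> f = col_of C B k"
    and "k' \<in> fst B \<Longrightarrow> k' \<noteq> k \<Longrightarrow> C k' (col_of C B k) = 0"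
proof -
  obtain \<sigma> where \<sigma>: "bij_betw \<sigma> (fst B) (snd B)"
    "\<forall>k\<in>fst B. \<forall>f\<in>snd B. C k f = (if f = \<sigma> k then 1 else 0)"
    using assms(1) unfolding identity_submatrix_def by blast
  have mem: "\<sigma> k \<in> snd B" using \<sigma>(1) assms(2) by (rule bij_betwE[THEN bspec])
  have "col_of C B k = \<sigma> k"
    unfolding col_of_def
    by (rule the_equality) (use \<sigma>(2) mem assms(2) in \<open>auto, metis zero_neq_one\<close>)
  then show "col_of C B k \<in> snd B" "f \<in> snd B \<Longrightarrow> C k f = 1 \<longleftrightarrow> f = col_of C B k"
    "k' \<in> fst B \<Longrightarrow> k' \<noteq> k \<Longrightarrow> C k' (col_of C B k) = 0"
    using \<sigma> mem assms(2) by (auto simp: bij_betw_def inj_on_def)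
qed

section \<open>XOR of bit strings\<close>

lemma length_xor_sum [simp]: "length (xor_sum T I w) = T"
  by (simp add: xor_sum_def)

lemma nth_xor_sum [simp]: "t < T \<Longrightarrow> xor_sum T I w ! t = (\<Sum>i\<in>I. w i ! t)"
  by (simp add: xor_sum_def)

lemma xor_sum_cong: "(\<And>i. i \<in> I \<Longrightarrow> w i = w' i) \<Longrightarrow> xor_sum T I w = xor_sum T I w'"
  by (simp add: xor_sum_def)

text \<open>In characteristic 2, adding the remaining summands a second time cancels them.\<close>

lemma xor_sum_recover:
  assumes "finite I" "k \<in> I" "length (w k) = T"
  shows "w k = map2 (+) (xor_sum T I w) (xor_sum T (I - {k}) w)"
proof (rule nth_equalityI)
  fix t assume "t < length (w k)"
  then have t: "t < T" using assms(3) by simp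
  have "(\<Sum>i\<in>I. w i ! t) = w k ! t + (\<Sum>i\<in>I - {k}. w i ! t)"
    using assms(1,2) by (rule sum.remove)
  moreover have "a + b + b = a" for a b :: bit
    by (cases b) simp_all
  ultimately show "w k ! t = map2 (+) (xor_sum T I w) (xor_sum T (I - {k}) w) ! t"
    using t by simp
qed (use assms in simp)

lemma reduce_assignment_in_range:
  assumes "reduce_assignment KK Q \<beta> q" "k \<in> KK" "b \<in> {1..\<beta>}"
  shows "q k b \<in> {1..Q}"
proof -
  have "q k b \<in> (\<Union>k\<in>KK. reduce_set q \<beta> k)"
    using assms(2,3) unfolding reduce_set_def by blast
  then show ?thesis using assms(1) unfolding reduce_assignment_def by simp
qed

lemma mapped_ivas_apply:
  "j \<in> {1..Q} \<Longrightarrow> f \<in> FF \<Longrightarrow> C k f = 0 \<Longrightarrow> mapped_ivas Q FF C v k (j, f) = v j f"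
  by (simp add: mapped_ivas_def)

section \<open>Correctness of the scheme for any admissible choice of transmitters\<close>

context
  fixes KK :: "'k set" and FF :: "'f set" and C :: "'k \<Rightarrow> 'f \<Rightarrow> bit"
    and g Q T \<beta> :: nat
    and \<CC> :: "('k, 'f) submatrix set" and q :: "'k \<Rightarrow> nat \<Rightarrow> nat"
    and p m :: "('k, 'f) submatrix \<Rightarrow> 'k"
  assumes sub: "\<forall>B\<in>\<CC>. identity_submatrix KK FF C g B"
    and asg: "reduce_assignment KK Q \<beta> q"
    and choice: "transmitter_choice \<CC> p m"
begin

lemma rows: "B \<in> \<CC> \<Longrightarrow> fst B \<subseteq> KK"
  using sub unfolding identity_submatrix_def by blast

lemma q_in_range:
  assumes "B \<in> \<CC>" "k \<in> fst B" "b \<in> {1..\<beta>}"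
  shows "q k b \<in> {1..Q}"
  using reduce_assignment_in_range[OF asg _ assms(3)] rows[OF assms(1)] assms(2) by blast

lemma col_of_in_FF:
  assumes "B \<in> \<CC>" "k \<in> fst B"
  shows "col_of C B k \<in> FF"
proof -
  have B: "identity_submatrix KK FF C g B" using sub assms(1) by blast
  then have "snd B \<subseteq> FF" unfolding identity_submatrix_def by blast
  then show ?thesis using identity_submatrix_col_of(1)[OF B assms(2)] by blast
qed

text \<open>Serves both directions: senders encode with these values, and receivers cancel
  interference with them.\<close>

lemma mapped_ivas_other_row:
  assumes "B \<in> \<CC>" "k \<in> fst B" "k' \<in> fst B" "k' \<noteq> k" "b \<in> {1..\<beta>}"
  shows "mapped_ivas Q FF C v k' (q k b, col_of C B k) = v (q k b) (col_of C B k)"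
proof (rule mapped_ivas_apply)
  show "q k b \<in> {1..Q}" using assms by (intro q_in_range)
  show "col_of C B k \<in> FF" using assms by (intro col_of_in_FF)
  show "C k' (col_of C B k) = 0" using assms sub by (blast intro: identity_submatrix_col_of(3))
qed

lemma choiceD:
  assumes "B \<in> \<CC>"
  shows "p B \<in> fst B" "m B \<in> fst B" "m B \<noteq> p B"
  using choice assms unfolding transmitter_choice_def by auto

lemma all_broadcastsD:
  assumes "x \<in> all_broadcasts \<CC> \<beta>"
  shows "x = Coded B b \<Longrightarrow> B \<in> \<CC> \<and> b \<in> {1..\<beta>}"
    and "x = Uncoded B b \<Longrightarrow> B \<in> \<CC> \<and> b \<in> {1..\<beta>}"
  using assms by (auto simp: all_broadcasts_def coded_broadcasts_def uncoded_broadcasts_def)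

text \<open>No sender needs a value of its own row: the coded sum omits row \<open>p B\<close>, and
  the uncoded value belongs to row \<open>p B\<close> but is sent by \<open>m B\<close>, a different
  row. The encoders read only the table \<open>M\<close> of mapped values, so they do not depend on
  \<open>v\<close>.\<close>

lemma scheme_transmittable:
  "transmittable KK FF C Q T (all_broadcasts \<CC> \<beta>) (sender p m) (message C T q p)"
  unfolding transmittable_def
proof (intro ballI conjI)
  fix x assume x: "x \<in> all_broadcasts \<CC> \<beta>"
  show "sender p m x \<in> KK"
    using all_broadcastsD[OF x] choiceD rows by (cases x) fastforce+
  show "\<exists>enc. \<forall>v\<in>ivas Q FF T.
      message C T q p v x = enc (mapped_ivas Q FF C v (sender p m x))"
  proof (cases x)
    case (Coded B b)
    note B = all_broadcastsD(1)[OF x Coded]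
    have "message C T q p v x = xor_sum T (fst B - {p B})
        (\<lambda>k. mapped_ivas Q FF C v (sender p m x) (q k b, col_of C B k))" for v
      unfolding Coded message.simps sender.simps
      by (rule xor_sum_cong, rule mapped_ivas_other_row[symmetric]) (use B choiceD in blast)+
    then show ?thesis
      by (intro exI[of _ "\<lambda>M. xor_sum T (fst B - {p B}) (\<lambda>k. M (q k b, col_of C B k))"]) blast
  next
    case (Uncoded B b)
    note B = all_broadcastsD(2)[OF x Uncoded]
    have "message C T q p v x =
        mapped_ivas Q FF C v (sender p m x) (q (p B) b, col_of C B (p B))" for v
      unfolding Uncoded message.simps sender.simps
      by (rule mapped_ivas_other_row[symmetric]) (use B choiceD in blast)+
    then show ?thesis
      by (intro exI[of _ "\<lambda>M. M (q (p B) b, col_of C B (p B))"]) blast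
  qed
qed

lemma scheme_delivers:
  assumes "identity_cover KK FF C \<CC>" "finite KK"
  shows "delivers KK FF C Q T \<beta> q (all_broadcasts \<CC> \<beta>) (message C T q p)"
  unfolding delivers_def
proof (intro ballI impI)
  fix k j f
  assume k: "k \<in> KK" and "j \<in> reduce_set q \<beta> k" and f: "f \<in> FF" "C k f = 1"
  then obtain b where b: "j = q k b" "b \<in> {1..\<beta>}"
    unfolding reduce_set_def by blast
  obtain B where B: "B \<in> \<CC>" and kB: "k \<in> fst B" and fB: "f \<in> snd B"
    using assms(1) k f unfolding identity_cover_def covers_def by blast
  have f_eq: "f = col_of C B k"
    using identity_submatrix_col_of(2)[OF sub[rule_format, OF B] kB fB] f(2) by simp
  let ?w = "\<lambda>v k. v (q k b) (col_of C B k)"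
  have mem: "Coded B b \<in> all_broadcasts \<CC> \<beta>" "Uncoded B b \<in> all_broadcasts \<CC> \<beta>"
    using B b(2) unfolding all_broadcasts_def coded_broadcasts_def uncoded_broadcasts_def by blast+
  show "\<exists>dec. \<forall>v\<in>ivas Q FF T. v j f =
      dec (mapped_ivas Q FF C v k) (restrict (message C T q p v) (all_broadcasts \<CC> \<beta>))"
  \<comment> \<open>Server \<open>p B\<close> reads its value directly from the uncoded broadcast;
    every other row of \<open>B\<close> decodes the coded one.\<close>
  proof (cases "k = p B")
    case True
    then show ?thesis
      using mem b(1) f_eq by (intro exI[of _ "\<lambda>M Y. Y (Uncoded B b)"]) simp
  next
    case False
    let ?I = "fst B - {p B}"
    have "v j f = map2 (+) (restrict (message C T q p v) (all_broadcasts \<CC> \<beta>) (Coded B b))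
        (xor_sum T (?I - {k}) (\<lambda>k'. mapped_ivas Q FF C v k (q k' b, col_of C B k')))"
      if v: "v \<in> ivas Q FF T" for v
    proof -
      have fin: "finite ?I" using rows[OF B] assms(2) finite_subset by blast
      have "length (?w v k) = T"
        \<comment> \<open>The range facts matter because \<open>ivas\<close> fixes lengths only for
          indices in \<open>{1..Q}\<close> and \<open>FF\<close>.\<close>
        using v q_in_range[OF B kB b(2)] col_of_in_FF[OF B kB] unfolding ivas_def by blast
      then have "?w v k = map2 (+) (xor_sum T ?I (?w v)) (xor_sum T (?I - {k}) (?w v))"
        using xor_sum_recover[OF fin, of k "?w v" T] False kB by simp
      \<comment> \<open>The terms to cancel belong to rows other than \<open>k\<close>, so
        \<open>k\<close> has mapped them all.\<close>
      also have "xor_sum T (?I - {k}) (?w v) =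
          xor_sum T (?I - {k}) (\<lambda>k'. mapped_ivas Q FF C v k (q k' b, col_of C B k'))"
        using mapped_ivas_other_row[OF B _ kB _ b(2)] by (intro xor_sum_cong) auto
      finally show ?thesis using b(1) f_eq mem by simp
    qed
    then show ?thesis
      by (intro exI[of _ "\<lambda>M Y. map2 (+) (Y (Coded B b))
        (xor_sum T (?I - {k}) (\<lambda>k'. M (q k' b, col_of C B k')))"]) blast
  qed
qed

lemma length_message:
  assumes "v \<in> ivas Q FF T" "x \<in> all_broadcasts \<CC> \<beta>"
  shows "length (message C T q p v x) = T"
proof (cases x)
  case (Uncoded B b)
  then have B: "B \<in> \<CC>" "b \<in> {1..\<beta>}"
    using all_broadcastsD(2)[OF assms(2)] by auto
  have "q (p B) b \<in> {1..Q}" "col_of C B (p B) \<in> FF"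
    using q_in_range[OF B(1) choiceD(1)[OF B(1)] B(2)]
      col_of_in_FF[OF B(1) choiceD(1)[OF B(1)]] .
  then show ?thesis
    using assms(1) unfolding Uncoded ivas_def by simp
qed simp

text \<open>Reduces the load to counting broadcasts. The set \<open>X\<close> is left free so that
  the coded and the uncoded broadcasts can be counted separately.\<close>

lemma bits_sent_eq_card:
  assumes "v \<in> ivas Q FF T" "X \<subseteq> all_broadcasts \<CC> \<beta>"
  shows "bits_sent X (sender p m) (message C T q p) v k = card {x \<in> X. sender p m x = k} * T"
proof -
  have "bits_sent X (sender p m) (message C T q p) v k = (\<Sum>x\<in>{x \<in> X. sender p m x = k}. T)"
    unfolding bits_sent_def using assms length_message by (intro sum.cong) auto
  then show ?thesis by simp
qed

end

section \<open>Counting the broadcasts of each server\<close>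

lemma card_coded_broadcasts_from:
  "card {x \<in> coded_broadcasts \<CC> \<beta>. sender p m x = k} = card {B \<in> \<CC>. p B = k} * \<beta>"
proof -
  have "{x \<in> coded_broadcasts \<CC> \<beta>. sender p m x = k} =
      case_prod Coded ` ({B \<in> \<CC>. p B = k} \<times> {1..\<beta>})"
    by (auto simp: coded_broadcasts_def)
  moreover have "inj_on (case_prod Coded) ({B \<in> \<CC>. p B = k} \<times> {1..\<beta>})"
    by (auto simp: inj_on_def)
  ultimately show ?thesis by (simp add: card_image card_cartesian_product)
qed

lemma card_uncoded_broadcasts_from:
  "card {x \<in> uncoded_broadcasts \<CC> \<beta>. sender p m x = k} = card {B \<in> \<CC>. m B = k} * \<beta>"
proof -
  have "{x \<in> uncoded_broadcasts \<CC> \<beta>. sender p m x = k} =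
      case_prod Uncoded ` ({B \<in> \<CC>. m B = k} \<times> {1..\<beta>})"
    by (auto simp: uncoded_broadcasts_def)
  moreover have "inj_on (case_prod Uncoded) ({B \<in> \<CC>. m B = k} \<times> {1..\<beta>})"
    by (auto simp: inj_on_def)
  ultimately show ?thesis by (simp add: card_image card_cartesian_product)
qed

lemma finite_broadcasts:
  assumes "finite \<CC>"
  shows "finite (coded_broadcasts \<CC> \<beta>)" "finite (uncoded_broadcasts \<CC> \<beta>)"
proof -
  have "coded_broadcasts \<CC> \<beta> = case_prod Coded ` (\<CC> \<times> {1..\<beta>})"
    "uncoded_broadcasts \<CC> \<beta> = case_prod Uncoded ` (\<CC> \<times> {1..\<beta>})"
    by (auto simp: coded_broadcasts_def uncoded_broadcasts_def)
  then show "finite (coded_broadcasts \<CC> \<beta>)" "finite (uncoded_broadcasts \<CC> \<beta>)"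
    using assms by simp_all
qed

lemma bits_sent_all_broadcasts:
  assumes "finite \<CC>"
  shows "bits_sent (all_broadcasts \<CC> \<beta>) s f v k =
    bits_sent (coded_broadcasts \<CC> \<beta>) s f v k + bits_sent (uncoded_broadcasts \<CC> \<beta>) s f v k"
proof -
  have "{x \<in> all_broadcasts \<CC> \<beta>. s x = k} =
      {x \<in> coded_broadcasts \<CC> \<beta>. s x = k} \<union> {x \<in> uncoded_broadcasts \<CC> \<beta>. s x = k}"
    by (auto simp: all_broadcasts_def)
  then show ?thesis
    unfolding bits_sent_def using finite_broadcasts[OF assms, of \<beta>]
    by (simp only:) (rule sum.union_disjoint; auto simp: coded_broadcasts_def uncoded_broadcasts_def)
qed

theorem theorem7:
  fixes KK :: "'k set" and FF :: "'f set" and C :: "'k \<Rightarrow> 'f \<Rightarrow> bit"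
    and K F r g S Q T \<beta> :: nat
    and \<CC> :: "('k, 'f) submatrix set" and q :: "'k \<Rightarrow> nat \<Rightarrow> nat"
  assumes "computing_matrix KK FF K F r C"
    and "F \<ge> K"
    and "identity_cover KK FF C \<CC>"
    and "non_overlapping KK FF C \<CC>"
    and "card \<CC> = S"
    and "g \<ge> 2"
    and "\<forall>B\<in>\<CC>. identity_submatrix KK FF C g B"
    and "Q = \<beta> * K"
    and "reduce_assignment KK Q \<beta> q"
    and "K dvd S"
    and "\<exists>d. \<forall>k\<in>KK. card {B \<in> \<CC>. k \<in> fst B} = d"
  shows "\<exists>p m. transmitter_choice \<CC> p m \<and>
     transmittable KK FF C Q T (all_broadcasts \<CC> \<beta>) (sender p m) (message C T q p) \<and>
     delivers KK FF C Q T \<beta> q (all_broadcasts \<CC> \<beta>) (message C T q p) \<and>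
     (\<forall>v\<in>ivas Q FF T. \<forall>k\<in>KK.
        real (bits_sent (all_broadcasts \<CC> \<beta>) (sender p m) (message C T q p) v k)
          = 2 * real S * real \<beta> * real T / real K \<and>
        real (bits_sent (coded_broadcasts \<CC> \<beta>) (sender p m) (message C T q p) v k)
          = real S * real \<beta> * real T / real K \<and>
        real (bits_sent (uncoded_broadcasts \<CC> \<beta>) (sender p m) (message C T q p) v k)
          = real S * real \<beta> * real T / real K)"
proof -
  have finKK: "finite KK" and cardKK: "card KK = K" and finFF: "finite FF"
    using assms(1) unfolding computing_matrix_def by auto
  have rows: "fst B \<subseteq> KK" "card (fst B) = g" "snd B \<subseteq> FF" if "B \<in> \<CC>" for B
    using assms(7) that unfolding identity_submatrix_def by auto
  \<comment> \<open>Finiteness has to come from the index sets: \<open>card \<CC> = S\<close> does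
    not give it when \<open>S = 0\<close>, as \<open>card\<close> is 0 on infinite sets.\<close>
  have "\<CC> \<subseteq> Pow KK \<times> Pow FF"
    using rows(1,3) unfolding mem_Times_iff subset_iff by blast
  then have fin: "finite \<CC>"
    using finKK finFF by (meson finite_Pow_iff finite_SigmaI finite_subset)
  obtain d where d: "\<forall>k\<in>KK. card {B \<in> \<CC>. k \<in> fst B} = d"
    using assms(11) by blast
  obtain \<gamma> where \<gamma>: "S = K * \<gamma>"
    using assms(10) by blast
  \<comment> \<open>Counting row incidences both ways gives \<open>S * g = K * d\<close>, which
    determines the common degree \<open>d\<close> as \<open>\<gamma> * g\<close>.\<close>
  have "(\<Sum>B\<in>\<CC>. card (fst B)) = (\<Sum>k\<in>KK. card {B \<in> \<CC>. k \<in> fst B})"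
    using fin finKK rows(1) by (rule sum_card_incidence)
  then have "K * \<gamma> * g = K * d"
    using rows(2) d cardKK assms(5) \<gamma> by simp
  \<comment> \<open>Any server at all makes \<open>K\<close> positive, so \<open>K\<close> can be
    cancelled; with no servers the claims about each server are vacuous.\<close>
  moreover have "K > 0" if "k \<in> KK" for k
    using that finKK cardKK card_gt_0_iff by blast
  ultimately have deg: "card {B \<in> \<CC>. k \<in> fst B} = \<gamma> * g" if "k \<in> KK" for k
    using that d by fastforce
  obtain p m where pm: "\<forall>B\<in>\<CC>. p B \<in> fst B \<and> m B \<in> fst B \<and> p B \<noteq> m B"
    and bal: "\<forall>k\<in>KK. card {B \<in> \<CC>. p B = k} = \<gamma> \<and> card {B \<in> \<CC>. m B = k} = \<gamma>"
    using two_balanced_representatives[OF fin finKK assms(6) rows(1,2) deg] by blast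
  from pm have choice: "transmitter_choice \<CC> p m"
    unfolding transmitter_choice_def .
  note scheme = assms(7,9) choice
  have subs: "coded_broadcasts \<CC> \<beta> \<subseteq> all_broadcasts \<CC> \<beta>"
    "uncoded_broadcasts \<CC> \<beta> \<subseteq> all_broadcasts \<CC> \<beta>"
    by (auto simp: all_broadcasts_def)
  let ?bits = "\<lambda>X v k. real (bits_sent X (sender p m) (message C T q p) v k)"
  let ?L = "real S * real \<beta> * real T / real K"
  have bits: "?bits (coded_broadcasts \<CC> \<beta>) v k = ?L \<and> ?bits (uncoded_broadcasts \<CC> \<beta>) v k = ?L"
    if v: "v \<in> ivas Q FF T" and k: "k \<in> KK" for v k
  proof -
    \<comment> \<open>Each server sends for \<gamma> submatrices in each role, with \<beta> messages
      of \<open>T\<close> bits per submatrix.\<close>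
    have "?L = real (\<gamma> * \<beta> * T)"
      using \<gamma> \<open>\<And>k. k \<in> KK \<Longrightarrow> K > 0\<close>[OF k] by simp
    then show ?thesis
      using bits_sent_eq_card[OF scheme v subs(1)] bits_sent_eq_card[OF scheme v subs(2)] bal k
      by (simp add: card_coded_broadcasts_from card_uncoded_broadcasts_from)
  qed
  moreover have "?bits (all_broadcasts \<CC> \<beta>) v k = 2 * real S * real \<beta> * real T / real K"
    if "v \<in> ivas Q FF T" "k \<in> KK" for v k
    using bits[OF that] by (simp add: bits_sent_all_broadcasts[OF fin])
  ultimately show ?thesis
    using choice scheme_transmittable[OF scheme] scheme_delivers[OF scheme assms(3) finKK]
    by (intro exI[of _ p] exI[of _ m]) simp
qed

end
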